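(* Consider the sampling model on a finite graph $G=(V,E)$ (described in the context), with an arbitrary prior $\nu$ on $\mathbb{R}^d$ and an arbitrary signal structure $\{\mathbb{P}_i(\cdot\mid\theta)\}_{i\in V}$. For every agent $i\in V$, the sequence of (random) posterior distributions $\nu_i(t)$ converges weakly, as $t\to\infty$, to $\nu_i(\infty):=\mathrm{Law}(\theta\mid\mathcal{H}_i(\infty))$, almost surely. Furthermore, if agents $i$ and $j$ are connected in $G$, then $\nu_i(\infty)=\nu_j(\infty)$ almost surely. Therefore, if $G$ is connected, all agents agree asymptotically, i.e. almost surely $\nu_i(\infty)=\nu_j(\infty)$ for all $i,j\in V$.
   Context: Sampling model. Let $G=(V,E)$ be a finite undirected graph with $V=[n]=\{1,\dots,n\}$, and let $\partial i\subseteq V$ denote the set of neighbors of $i$. An unknown state $\theta\in\mathbb{R}^d$ is drawn from a prior $\nu$ (a Borel probability measure on $\mathbb{R}^d$). Each agent $i\in V$ obtains a private signal $S_i\in\mathbb{R}^d$ with $S_i\sim\mathbb{P}_i(\cdot\mid\theta)$, where $\mathbb{P}_i(\cdot\mid\theta)$ is a probability measure on $\mathbb{R}^d$ (a probability kernel in $\theta$); the signals $S_1,\dots,S_n$ are conditionally independent given $\theta$. The collection $\{\mathbb{P}_i(\cdot\mid\theta)\}_{i\in V}$ is called the signal structure. For $t=1,2,\dots$, the information of agent $i$ at time $t$ is the $\sigma$-algebra $\mathcal{H}_i(t):=\sigma\big(S_i,(Y_j(s))_{j\in\partial i,\,1\le s<t}\big)$ (so $\mathcal{H}_i(1)=\sigma(S_i)$),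 and its posterior is the random probability measure $\nu_i(t):=\mathrm{Law}(\theta\mid\mathcal{H}_i(t))$ (regular conditional distribution). At time $t$, each agent $i$ samples $Y_i(t)\sim\nu_i(t)$ given $\mathcal{H}_i(t)$, conditionally independently of all other information; that is, conditionally on $\theta$, $(S_j)_{j\in V}$ and $(Y_j(s))_{j\in V,\,s<t}$, the variables $(Y_i(t))_{i\in V}$ are independent and $Y_i(t)$ has law $\nu_i(t)$. Agent $i$ then communicates $Y_i(t)$ to all its neighbors. Let $\mathcal{H}_i(\infty)$ be the $\sigma$-algebra generated by $\bigcup_{t\ge1}\mathcal{H}_i(t)$. *)

theory Defs
  imports "HOL-Probability.Probability" "Graph_Theory.Graph_Theory"
begin

definition generated_algebra :: "'w measure \<Rightarrow> ('w \<Rightarrow> 'a::topological_space) set \<Rightarrow> 'w measure" where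
  "generated_algebra M \<X> = sigma (space M) {X -` A \<inter> space M | X A. X \<in> \<X> \<and> A \<in> sets borel}"

text \<open>
  \<open>K\<close> is a version of the regular conditional distribution of \<open>X\<close> given \<open>F\<close>.  It is determined
  only up to null sets, and is therefore a relation.
\<close>
definition regular_cond_law ::
  "'w measure \<Rightarrow> 'w measure \<Rightarrow> ('w \<Rightarrow> 'a::topological_space) \<Rightarrow> ('w \<Rightarrow> 'a measure) \<Rightarrow> bool" where
  "regular_cond_law M F X K \<longleftrightarrow>
     K \<in> F \<rightarrow>\<^sub>M prob_algebra borel \<and>
     (\<forall>A\<in>sets borel. AE w in M.
        measure (K w) A = real_cond_exp M F (indicator (X -` A \<inter> space M)) w)"

definition cond_indep_vars ::
  "'w measure \<Rightarrow> 'w measure \<Rightarrow> ('i \<Rightarrow> 'w \<Rightarrow> 'a::topological_space) \<Rightarrow> 'i set \<Rightarrow> bool" where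
  "cond_indep_vars M F X I \<longleftrightarrow>
     (\<forall>J A. J \<subseteq> I \<longrightarrow> J \<noteq> {} \<longrightarrow> finite J \<longrightarrow> (\<forall>i\<in>J. A i \<in> sets borel) \<longrightarrow>
       (AE w in M.
          real_cond_exp M F (indicator (\<Inter>i\<in>J. X i -` A i \<inter> space M)) w =
          (\<Prod>i\<in>J. real_cond_exp M F (indicator (X i -` A i \<inter> space M)) w)))"

text \<open>The library's \<open>weak_conv_m\<close> is defined through distribution functions, hence only on the line.\<close>
definition weakly_converges :: "(nat \<Rightarrow> 'a::topological_space measure) \<Rightarrow> 'a measure \<Rightarrow> bool" where
  "weakly_converges \<mu> \<mu>' \<longleftrightarrow>
     (\<forall>f :: 'a \<Rightarrow> real. continuous_on UNIV f \<longrightarrow> bounded (range f) \<longrightarrow>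
        (\<lambda>t. integral\<^sup>L (\<mu> t) f) \<longlonglongrightarrow> integral\<^sup>L \<mu>' f)"

definition neighbors :: "(nat, 'e) pre_digraph \<Rightarrow> nat \<Rightarrow> nat set" where
  "neighbors G i = {j. i \<rightarrow>\<^bsub>G\<^esub> j}"

definition agent_info ::
  "'w measure \<Rightarrow> (nat, 'e) pre_digraph \<Rightarrow> (nat \<Rightarrow> 'w \<Rightarrow> real ^ 'd) \<Rightarrow>
   (nat \<Rightarrow> nat \<Rightarrow> 'w \<Rightarrow> real ^ 'd) \<Rightarrow> nat \<Rightarrow> nat \<Rightarrow> 'w measure" where
  "agent_info M G S Y i t =
     generated_algebra M ({S i} \<union> {Y j s | j s. j \<in> neighbors G i \<and> 1 \<le> s \<and> s < t})"

definition agent_info_limit ::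
  "'w measure \<Rightarrow> (nat, 'e) pre_digraph \<Rightarrow> (nat \<Rightarrow> 'w \<Rightarrow> real ^ 'd) \<Rightarrow>
   (nat \<Rightarrow> nat \<Rightarrow> 'w \<Rightarrow> real ^ 'd) \<Rightarrow> nat \<Rightarrow> 'w measure" where
  "agent_info_limit M G S Y i = sigma (space M) (\<Union>t\<in>{1..}. sets (agent_info M G S Y i t))"

definition global_info ::
  "'w measure \<Rightarrow> nat set \<Rightarrow> ('w \<Rightarrow> real ^ 'd) \<Rightarrow> (nat \<Rightarrow> 'w \<Rightarrow> real ^ 'd) \<Rightarrow>
   (nat \<Rightarrow> nat \<Rightarrow> 'w \<Rightarrow> real ^ 'd) \<Rightarrow> nat \<Rightarrow> 'w measure" where
  "global_info M V \<theta> S Y t =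
     generated_algebra M ({\<theta>} \<union> S ` V \<union> {Y j s | j s. j \<in> V \<and> 1 \<le> s \<and> s < t})"

text \<open>
  \<open>M\<close> is an arbitrary probability space carrying the model.  The graph is a symmetric, loop-free
  digraph.  Times start at 1: the values of \<open>Y\<close> and \<open>post\<close> at time 0 play no role.  \<open>post i t\<close> is
  an arbitrary version of the posterior of agent \<open>i\<close> at time \<open>t\<close>.
\<close>
locale sampling_model = prob_space M + graph G
  for M :: "'w measure" and G :: "(nat, 'e) pre_digraph" +
  fixes n :: nat
    and \<nu> :: "(real ^ 'd) measure"
    and P :: "nat \<Rightarrow> real ^ 'd \<Rightarrow> (real ^ 'd) measure"
    and \<theta> :: "'w \<Rightarrow> real ^ 'd"
    and S :: "nat \<Rightarrow> 'w \<Rightarrow> real ^ 'd"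
    and Y :: "nat \<Rightarrow> nat \<Rightarrow> 'w \<Rightarrow> real ^ 'd"
    and post :: "nat \<Rightarrow> nat \<Rightarrow> 'w \<Rightarrow> (real ^ 'd) measure"
  assumes verts_eq: "verts G = {1..n}"
    and prior: "\<nu> \<in> space (prob_algebra borel)"
    and signal_kernel: "\<And>i. i \<in> {1..n} \<Longrightarrow> P i \<in> borel \<rightarrow>\<^sub>M prob_algebra borel"
    and state_measurable: "\<theta> \<in> borel_measurable M"
    and signal_measurable: "\<And>i. i \<in> {1..n} \<Longrightarrow> S i \<in> borel_measurable M"
    and sample_measurable: "\<And>i t. i \<in> {1..n} \<Longrightarrow> 1 \<le> t \<Longrightarrow> Y i t \<in> borel_measurable M"
    and state_law: "distr M borel \<theta> = \<nu>"
    and signal_law: "\<And>i. i \<in> {1..n} \<Longrightarrow>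
      regular_cond_law M (generated_algebra M {\<theta>}) (S i) (\<lambda>w. P i (\<theta> w))"
    and signals_cond_indep: "cond_indep_vars M (generated_algebra M {\<theta>}) S {1..n}"
    and posterior: "\<And>i t. i \<in> {1..n} \<Longrightarrow> 1 \<le> t \<Longrightarrow>
      regular_cond_law M (agent_info M G S Y i t) \<theta> (post i t)"
    and sample_law: "\<And>i t. i \<in> {1..n} \<Longrightarrow> 1 \<le> t \<Longrightarrow>
      regular_cond_law M (global_info M {1..n} \<theta> S Y t) (Y i t) (post i t)"
    and samples_cond_indep: "\<And>t. 1 \<le> t \<Longrightarrow>
      cond_indep_vars M (global_info M {1..n} \<theta> S Y t) (\<lambda>i. Y i t) {1..n}"

end

theory Submission
  imports Defs
begin

text \<open>
  Fix a Borel set \<open>A\<close>. The posterior probabilities of \<open>A\<close> held by an agent are the conditional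
  expectations of the indicator of \<open>\<theta> \<in> A\<close> along the increasing information of that agent, hence a bounded
  martingale, and by Levy's upward theorem (\<open>levy_upward\<close>) they converge almost surely to the
  conditional probability given the limiting information. Convergence on the finite unions of a
  countable basis suffices for weak convergence (\<open>weakly_converges_if_convergence_on_union_basis\<close>), which
  leaves countably many null sets.

  For the agreement, let \<open>j\<close> be a neighbor of \<open>i\<close>, write \<open>X_i(t)\<close>, \<open>X_j(t)\<close> for the posterior
  probabilities of \<open>A\<close> and \<open>X_i\<close>, \<open>X_j\<close> for their limits, and let \<open>B_t\<close> be the event that the sample
  \<open>Y_j(t)\<close> lies in \<open>A\<close>. Since \<open>i\<close> observes the sample, and the sample has conditional law
  \<open>post j t\<close> given everything before it, including \<open>\<theta>\<close>,
  \<open>E[X_i 1_{B_t}] = P(\<theta> \<in> A, B_t) = E[1_{\<theta> \<in> A} X_j(t)] = E[X_j(t)^2].\<close>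
  On the other hand \<open>X_i(t)\<close> is determined before the sample is drawn, so
  \<open>E[X_i(t) 1_{B_t}] = E[X_i(t) X_j(t)].\<close>
  The left-hand sides differ by at most \<open>E |X_i - X_i(t)|\<close>, which tends to \<open>0\<close>. In the limit
  \<open>E[X_j^2] = E[X_i X_j]\<close> (\<open>neighbor_limit_second_moment\<close>). As the neighbor relation is symmetric, also
  \<open>E[X_i^2] = E[X_i X_j]\<close>, so \<open>E[(X_i - X_j)^2] = 0\<close>. Letting \<open>A\<close> run through the countable family gives
  equality of the limiting posteriors of neighbors, and following a walk gives it for all agents
  connected in the graph.
\<close>

section \<open>Bounded martingales of conditional expectations\<close>

lemma AE_abs_mult_le:
  fixes f g :: "'a \<Rightarrow> real"
  assumes "AE w in M. \<bar>f w\<bar> \<le> A" "AE w in M. \<bar>g w\<bar> \<le> B"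
  shows "AE w in M. \<bar>f w * g w\<bar> \<le> A * B"
  using assms
proof eventually_elim
  case (elim w)
  then show ?case unfolding abs_mult by (intro mult_mono) auto
qed

lemma (in prob_space) integrable_mult_AE_bounded:
  fixes f g :: "'a \<Rightarrow> real"
  assumes "AE w in M. \<bar>f w\<bar> \<le> A" "AE w in M. \<bar>g w\<bar> \<le> B"
    and "f \<in> borel_measurable M" "g \<in> borel_measurable M"
  shows "integrable M (\<lambda>w. f w * g w)"
  using AE_abs_mult_le[OF assms(1,2)] assms(3,4) by (intro integrable_const_bound[of _ "A * B"]) auto

text \<open>
  Doob's maximal inequality. The induction carries the stronger bound by the integral of \<open>Q N\<close>
  over the event itself: the event for \<open>N + 1\<close> is the event \<open>E\<close> for \<open>N\<close> together with a disjoint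
  piece on which \<open>Q (N + 1) \<ge> c\<close>, and since \<open>E\<close> is known at time \<open>N\<close>, replacing \<open>Q N\<close> by
  \<open>Q (N + 1)\<close> only increases the integral over \<open>E\<close>.
\<close>
lemma (in prob_space) nonneg_submartingale_maximal_inequality:
  fixes Q :: "nat \<Rightarrow> 'a \<Rightarrow> real"
  assumes sub: "\<And>t. subalgebra M (F t)"
    and mono: "\<And>t. sets (F t) \<subseteq> sets (F (Suc t))"
    and adapted: "\<And>t. Q t \<in> borel_measurable (F t)"
    and int: "\<And>t. integrable M (Q t)"
    and nonneg: "\<And>t w. 0 \<le> Q t w"
    and submart: "\<And>t B. B \<in> sets (F t) \<Longrightarrow> (\<integral>w\<in>B. Q t w \<partial>M) \<le> (\<integral>w\<in>B. Q (Suc t) w \<partial>M)"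
  shows "c * prob {w \<in> space M. \<exists>k\<le>N. c \<le> Q k w} \<le> expectation (Q N)"
proof -
  define E where "E N = {w \<in> space M. \<exists>k\<le>N. c \<le> Q k w}" for N
  have spc: "space (F t) = space M" for t using sub by (simp add: subalgebra_def)
  have level: "{w \<in> space M. c \<le> Q t w} \<in> sets (F t)" for t
    using borel_measurable_le[of "\<lambda>_. c" "F t" "Q t"] adapted[of t] by (simp add: spc)
  have setint: "set_integrable M B (Q t)" if "B \<in> sets (F u)" for B t u
    using that sub[of u] int[of t] unfolding set_integrable_def subalgebra_def
    by (intro integrable_mult_indicator) auto
  have "E N \<in> sets (F N) \<and> c * prob (E N) \<le> (\<integral>w\<in>E N. Q N w \<partial>M)" for N
  proof (induction N)
    case 0
    have E0: "E 0 \<in> sets (F 0)" using level[of 0] by (simp add: E_def)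
    then have E0M: "E 0 \<in> sets M" using sub by (auto simp: subalgebra_def)
    have "c * prob (E 0) = (\<integral>w\<in>E 0. c \<partial>M)" using E0M by (simp add: set_lebesgue_integral_def mult.commute)
    also have "\<dots> \<le> (\<integral>w\<in>E 0. Q 0 w \<partial>M)"
      using E0M setint[OF E0] by (intro set_integral_mono) (auto simp: E_def set_integrable_def less_top[symmetric])
    finally show ?case using E0 by simp
  next
    case (Suc N)
    define B where "B = {w \<in> space M. c \<le> Q (Suc N) w} - E N"
    have EN: "E N \<in> sets (F (Suc N))" using Suc mono by auto
    have B: "B \<in> sets (F (Suc N))" using level[of "Suc N"] EN by (auto simp: B_def)
    have M: "B \<in> sets M" "E N \<in> sets M" using B EN sub by (auto simp: subalgebra_def)
    have split: "E (Suc N) = E N \<union> B" by (auto simp: E_def B_def le_Suc_eq)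
    have disj: "E N \<inter> B = {}" by (auto simp: B_def)
    have "c * prob B = (\<integral>w\<in>B. c \<partial>M)" using M by (simp add: set_lebesgue_integral_def mult.commute)
    also have "\<dots> \<le> (\<integral>w\<in>B. Q (Suc N) w \<partial>M)"
      using M setint[OF B] by (intro set_integral_mono) (auto simp: B_def set_integrable_def less_top[symmetric])
    finally have "c * prob B \<le> (\<integral>w\<in>B. Q (Suc N) w \<partial>M)" .
    moreover have "c * prob (E N) \<le> (\<integral>w\<in>E N. Q (Suc N) w \<partial>M)"
      using Suc submart by fastforce
    moreover have "prob (E (Suc N)) = prob (E N) + prob B"
      unfolding split using M disj by (intro finite_measure_Union) auto
    moreover have "(\<integral>w\<in>E (Suc N). Q (Suc N) w \<partial>M)
        = (\<integral>w\<in>E N. Q (Suc N) w \<partial>M) + (\<integral>w\<in>B. Q (Suc N) w \<partial>M)"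
      unfolding split using disj setint B EN by (intro set_integral_Un) auto
    ultimately show ?case using EN B by (simp add: split algebra_simps)
  qed
  moreover have "(\<integral>w\<in>E N. Q N w \<partial>M) \<le> expectation (Q N)"
    unfolding set_lebesgue_integral_def
    by (intro integral_mono_AE') (use int nonneg in \<open>auto simp: indicator_def\<close>)
  ultimately show ?thesis unfolding E_def by (meson order_trans)
qed

text \<open>
  The martingale of successive conditional expectations of one bounded variable along a filtration.
  Boundedness makes all products below integrable, so that everything can be done with second
  moments, and it gives dominated convergence at the end.
\<close>
locale bounded_doob_martingale = prob_space M
  for M :: "'w measure" +
  fixes F :: "nat \<Rightarrow> 'w measure" and X :: "'w \<Rightarrow> real" and C :: real
  assumes sub: "\<And>t. subalgebra M (F t)"
    and mono: "\<And>s t. s \<le> t \<Longrightarrow> sets (F s) \<subseteq> sets (F t)"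
    and X_measurable: "X \<in> borel_measurable M"
    and X_bounded: "AE w in M. \<bar>X w\<bar> \<le> C"
begin

abbreviation m :: "nat \<Rightarrow> 'w \<Rightarrow> real" where "m t \<equiv> real_cond_exp M (F t) X"

abbreviation F_inf :: "'w measure" where "F_inf \<equiv> sigma (space M) (\<Union>t. sets (F t))"

lemma space_F: "space (F t) = space M"
  using sub by (simp add: subalgebra_def)

lemma subalg_F: "s \<le> t \<Longrightarrow> subalgebra (F t) (F s)"
  using mono by (simp add: subalgebra_def space_F)

lemma sets_F_subset: "(\<Union>t. sets (F t)) \<subseteq> Pow (space M)"
  using sets.space_closed[of "F t" for t] by (auto simp: space_F)

lemma sets_F_infinity: "sets F_inf = sigma_sets (space M) (\<Union>t. sets (F t))"
  by (rule sets_measure_of[OF sets_F_subset])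

lemma space_F_infinity: "space F_inf = space M"
  by (rule space_measure_of[OF sets_F_subset])

lemma sub_infinity: "subalgebra M F_inf"
proof -
  have "(\<Union>t. sets (F t)) \<subseteq> sets M" using sub by (auto simp: subalgebra_def)
  then have "sigma_sets (space M) (\<Union>t. sets (F t)) \<subseteq> sets M" by (rule sets.sigma_sets_subset)
  then show ?thesis by (simp add: subalgebra_def sets_F_infinity space_F_infinity)
qed

lemma cond_exp_bounded:
  assumes "subalgebra M A"
  shows "AE w in M. \<bar>real_cond_exp M A X w\<bar> \<le> C"
proof -
  interpret A: finite_measure_subalgebra M A
    using assms by unfold_locales
  have "integrable M X" using X_bounded X_measurable by (intro integrable_const_bound[of _ C]) auto
  then have "AE w in M. - C \<le> real_cond_exp M A X w" "AE w in M. real_cond_exp M A X w \<le> C"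
    using X_bounded by (intro A.real_cond_exp_ge_c A.real_cond_exp_le_c; auto elim: eventually_mono)+
  then show ?thesis by auto
qed

lemma integrable_X: "integrable M X"
  using X_bounded X_measurable by (intro integrable_const_bound[of _ C]) auto

lemma m_adapted: "s \<le> t \<Longrightarrow> m s \<in> borel_measurable (F t)"
  by (rule measurable_from_subalg[OF subalg_F]) auto

lemma m_measurable [measurable]: "m t \<in> borel_measurable M"
  by simp

lemma m_bounded: "AE w in M. \<bar>m t w\<bar> \<le> C"
  by (rule cond_exp_bounded[OF sub])

lemma m_diff_bounded: "AE w in M. \<bar>m t w - m s w\<bar> \<le> 2 * C"
  using m_bounded[of s] m_bounded[of t] by eventually_elim auto

lemma expectation_mult_m:
  assumes "h \<in> borel_measurable (F s)" "AE w in M. \<bar>h w\<bar> \<le> D" "s \<le> t"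
  shows "integrable M (\<lambda>w. h w * m t w)"
    and "expectation (\<lambda>w. h w * m t w) = expectation (\<lambda>w. h w * X w)"
proof -
  interpret Ft: finite_measure_subalgebra M "F t"
    using sub by unfold_locales
  have ht: "h \<in> borel_measurable (F t)" using assms measurable_from_subalg[OF subalg_F] by blast
  have [measurable]: "h \<in> borel_measurable M" using assms(1) measurable_from_subalg[OF sub] by blast
  have "integrable M (\<lambda>w. h w * X w)"
    using assms(2) X_bounded X_measurable by (intro integrable_mult_AE_bounded) auto
  from Ft.real_cond_exp_intg[OF this ht X_measurable]
  show "integrable M (\<lambda>w. h w * m t w)"
    and "expectation (\<lambda>w. h w * m t w) = expectation (\<lambda>w. h w * X w)" by auto
qed

text \<open>
  Tested against a variable known at time \<open>s\<close>, both \<open>m s\<close> and \<open>m t\<close> can be replaced by \<open>X\<close>.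
\<close>
lemma increments_orthogonal:
  assumes "h \<in> borel_measurable (F s)" "AE w in M. \<bar>h w\<bar> \<le> D" "s \<le> t"
  shows "integrable M (\<lambda>w. h w * (m t w - m s w))"
    and "expectation (\<lambda>w. h w * (m t w - m s w)) = 0"
  using expectation_mult_m[OF assms] expectation_mult_m[OF assms(1,2) order_refl]
  by (simp_all add: right_diff_distrib)

lemma integrable_square_diff: "integrable M (\<lambda>w. (m t w - m s w)\<^sup>2)"
  unfolding power2_eq_square
  by (rule integrable_mult_AE_bounded[OF m_diff_bounded m_diff_bounded]) measurable

lemma integrable_square: "integrable M (\<lambda>w. (m t w)\<^sup>2)"
  unfolding power2_eq_square by (rule integrable_mult_AE_bounded[OF m_bounded m_bounded]) auto

text \<open>
  Pythagoras: the increment after time \<open>s\<close> is orthogonal to \<open>m s\<close>.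
\<close>
lemma expectation_square_diff:
  assumes "s \<le> t"
  shows "expectation (\<lambda>w. (m t w - m s w)\<^sup>2)
    = expectation (\<lambda>w. (m t w)\<^sup>2) - expectation (\<lambda>w. (m s w)\<^sup>2)"
proof -
  note orth = increments_orthogonal[OF m_adapted[of s s] m_bounded assms, simplified]
  have "(m t w - m s w)\<^sup>2 = (m t w)\<^sup>2 - (m s w)\<^sup>2 - 2 * (m s w * (m t w - m s w))" for w
    by (simp add: power2_eq_square algebra_simps)
  then show ?thesis using orth integrable_square by simp
qed

text \<open>
  Expanding the square of \<open>m (Suc t) - m s = (m (Suc t) - m t) + (m t - m s)\<close>, the mixed term integrates
  to \<open>0\<close> over \<open>B\<close>, because \<open>m t - m s\<close> restricted to \<open>B\<close> is known at time \<open>t\<close>.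
\<close>
lemma square_increments_submartingale:
  assumes "s \<le> t" "B \<in> sets (F t)"
  shows "(\<integral>w\<in>B. (m t w - m s w)\<^sup>2 \<partial>M) \<le> (\<integral>w\<in>B. (m (Suc t) w - m s w)\<^sup>2 \<partial>M)"
proof -
  define h where "h w = indicator B w * (m t w - m s w)" for w
  have BM: "B \<in> sets M" using assms sub by (auto simp: subalgebra_def)
  have h: "h \<in> borel_measurable (F t)"
    unfolding h_def using assms m_adapted[of s t] m_adapted[of t t] by measurable
  have hb: "AE w in M. \<bar>h w\<bar> \<le> 2 * C"
    using m_diff_bounded[of t s] by eventually_elim (auto simp: h_def indicator_def)
  note orth = increments_orthogonal[OF h hb, of "Suc t", simplified]
  have intB: "integrable M (\<lambda>w. indicator B w * (m u w - m v w)\<^sup>2)" for u v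
    using integrable_mult_indicator[OF BM integrable_square_diff] by simp
  have "indicator B w * (m (Suc t) w - m s w)\<^sup>2 = indicator B w * (m t w - m s w)\<^sup>2
      + indicator B w * (m (Suc t) w - m t w)\<^sup>2 + 2 * (h w * (m (Suc t) w - m t w))" for w
    by (simp add: h_def power2_eq_square algebra_simps)
  then have "(\<integral>w\<in>B. (m (Suc t) w - m s w)\<^sup>2 \<partial>M)
      = (\<integral>w\<in>B. (m t w - m s w)\<^sup>2 \<partial>M) + (\<integral>w\<in>B. (m (Suc t) w - m t w)\<^sup>2 \<partial>M)"
    using orth intB by (simp add: set_lebesgue_integral_def)
  moreover have "0 \<le> (\<integral>w\<in>B. (m (Suc t) w - m t w)\<^sup>2 \<partial>M)"
    unfolding set_lebesgue_integral_def by (intro integral_nonneg_AE) auto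
  ultimately show ?thesis by simp
qed

text \<open>
  The maximal inequality for the squared distance from \<open>m s\<close>. The bound is an increment of the second
  moments, which is what makes it small for late \<open>s\<close>.
\<close>
lemma tail_maximal_inequality:
  assumes "0 < e"
  shows "prob {w \<in> space M. \<exists>k\<le>N. e \<le> \<bar>m (s + k) w - m s w\<bar>}
    \<le> (expectation (\<lambda>w. (m (s + N) w)\<^sup>2) - expectation (\<lambda>w. (m s w)\<^sup>2)) / e\<^sup>2"
proof -
  have ad: "(\<lambda>w. (m (s + t) w - m s w)\<^sup>2) \<in> borel_measurable (F (s + t))" for t
    using m_adapted[of s "s + t"] m_adapted[of "s + t" "s + t"] by measurable
  have "e\<^sup>2 * prob {w \<in> space M. \<exists>k\<le>N. e\<^sup>2 \<le> (m (s + k) w - m s w)\<^sup>2}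
      \<le> expectation (\<lambda>w. (m (s + N) w - m s w)\<^sup>2)"
    using square_increments_submartingale[of s "s + t" for t]
    by (intro nonneg_submartingale_maximal_inequality[where F = "\<lambda>t. F (s + t)"])
       (auto simp: sub ad integrable_square_diff intro: mono[THEN subsetD, rotated])
  moreover have "e\<^sup>2 \<le> (m (s + k) w - m s w)\<^sup>2 \<longleftrightarrow> e \<le> \<bar>m (s + k) w - m s w\<bar>" for k w
    using assms abs_le_square_iff[of e "m (s + k) w - m s w"] by simp
  ultimately show ?thesis
    using assms by (simp add: expectation_square_diff field_simps)
qed

text \<open>
  The second moments of \<open>m t\<close> increase and are bounded by \<open>C\<^sup>2\<close>, hence converge, so by the maximal
  inequality the probability that \<open>m\<close> ever moves by \<open>e\<close> after time \<open>s\<close> tends to \<open>0\<close> as \<open>s\<close> grows.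
\<close>
lemma AE_Cauchy: "AE w in M. Cauchy (\<lambda>t. m t w)"
proof -
  define a where "a t = expectation (\<lambda>w. (m t w)\<^sup>2)" for t
  have "mono a"
  proof (rule monoI)
    fix s t :: nat assume "s \<le> t"
    have "0 \<le> expectation (\<lambda>w. (m t w - m s w)\<^sup>2)" by simp
    then show "a s \<le> a t" using expectation_square_diff[OF \<open>s \<le> t\<close>] by (simp add: a_def)
  qed
  have a_le: "a t \<le> C * C" for t
  proof -
    have "a t \<le> expectation (\<lambda>_. C * C)" unfolding a_def
      using AE_abs_mult_le[OF m_bounded[of t] m_bounded[of t]]
      by (intro integral_mono_AE integrable_square) (auto simp: power2_eq_square)
    then show ?thesis by (simp add: prob_space)
  qed
  obtain L where L: "a \<longlonglongrightarrow> L" and aL: "\<And>t. a t \<le> L"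
    using incseq_convergent[OF \<open>mono a\<close>, of "C * C"] a_le by auto
  have tail: "AE w in M. \<exists>s. \<forall>k. \<bar>m (s + k) w - m s w\<bar> < e" if "0 < e" for e
  proof -
    define E where "E s = {w \<in> space M. \<exists>k. e \<le> \<bar>m (s + k) w - m s w\<bar>}" for s
    have Em: "E s \<in> sets M" for s unfolding E_def by measurable
    have E_le: "prob (E s) \<le> (L - a s) / e\<^sup>2" for s
    proof -
      let ?E = "\<lambda>N. {w \<in> space M. \<exists>k\<le>N. e \<le> \<bar>m (s + k) w - m s w\<bar>}"
      have "(\<lambda>N. prob (?E N)) \<longlonglongrightarrow> prob (\<Union>N. ?E N)"
      proof (rule finite_Lim_measure_incseq)
        show "range ?E \<subseteq> sets M" by auto
        show "incseq ?E" by (auto simp: incseq_def intro: order_trans)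
      qed
      moreover have "(\<Union>N. ?E N) = E s" by (auto simp: E_def)
      moreover have "prob (?E N) \<le> (L - a s) / e\<^sup>2" for N
        using tail_maximal_inequality[OF \<open>0 < e\<close>, of N s] aL[of "s + N"] \<open>0 < e\<close>
        by (fold a_def) (smt (verit) divide_right_mono zero_le_power2)
      ultimately show ?thesis by (intro LIMSEQ_le_const2) auto
    qed
    have "prob (\<Inter>s. E s) \<le> (L - a s) / e\<^sup>2" for s
      using finite_measure_mono[of "\<Inter>s. E s" "E s"] Em E_le[of s] by (auto intro: order_trans)
    moreover have "(\<lambda>s. (L - a s) / e\<^sup>2) \<longlonglongrightarrow> (L - L) / e\<^sup>2"
      by (intro tendsto_intros L) (use \<open>0 < e\<close> in auto)
    ultimately have "prob (\<Inter>s. E s) \<le> 0" by (intro LIMSEQ_le_const) auto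
    then have "prob (\<Inter>s. E s) = 0" by (simp add: measure_le_0_iff)
    then have "(\<Inter>s. E s) \<in> null_sets M" using Em by (auto simp: null_sets_def emeasure_eq_measure)
    then show ?thesis by (rule AE_I') (auto simp: E_def not_less)
  qed
  have "AE w in M. \<forall>n. \<exists>s. \<forall>k. \<bar>m (s + k) w - m s w\<bar> < 1 / Suc n"
    unfolding AE_all_countable by (intro allI tail) simp
  then show ?thesis
  proof eventually_elim
    case (elim w)
    show ?case
    proof (rule metric_CauchyI)
      fix e :: real assume "0 < e"
      then obtain n where n: "1 / Suc n < e / 2" using nat_approx_posE[of "e / 2"] by auto
      obtain s where s: "\<And>k. \<bar>m (s + k) w - m s w\<bar> < 1 / Suc n" using elim by blast
      have "\<bar>m t w - m s w\<bar> < e / 2" if "s \<le> t" for t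
        using s[of "t - s"] n that by simp
      then have "dist (m t w) (m t' w) < e" if "s \<le> t" "s \<le> t'" for t t'
        using that by (smt (verit) dist_real_def field_sum_of_halves)
      then show "\<exists>M. \<forall>k\<ge>M. \<forall>n\<ge>M. dist (m k w) (m n w) < e" by blast
    qed
  qed
qed

text \<open>
  An event of some \<open>F s\<close> gives \<open>X\<close> and \<open>m t\<close> equal integrals for all \<open>t \<ge> s\<close>, hence \<open>X\<close> and \<open>Z\<close>
  equal integrals. The union of the \<open>F s\<close> is closed under intersection, because the \<open>F s\<close> are nested, so
  Dynkin's argument extends the equality to the sigma-algebra which it generates.
\<close>
lemma set_integral_limit_eq:
  assumes lim: "AE w in M. (\<lambda>t. m t w) \<longlonglongrightarrow> Z w" and Z: "integrable M Z"
    and A: "A \<in> sets F_inf"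
  shows "(\<integral>w\<in>A. X w \<partial>M) = (\<integral>w\<in>A. Z w \<partial>M)"
proof -
  have events: "A \<in> sets M" if "A \<in> sigma_sets (space M) (\<Union>t. sets (F t))" for A
    using that sub_infinity sets_F_infinity by (auto simp: subalgebra_def)
  have si: "set_integrable M A Z" "set_integrable M A X"
    if "A \<in> sigma_sets (space M) (\<Union>t. sets (F t))" for A
    unfolding set_integrable_def using events[OF that] Z integrable_X by (intro integrable_mult_indicator; simp)+
  have basic: "(\<integral>w\<in>A. X w \<partial>M) = (\<integral>w\<in>A. Z w \<partial>M)" if A: "A \<in> sets (F s)" for A s
  proof -
    have AM: "A \<in> sets M" using that sub by (auto simp: subalgebra_def)
    have ind: "indicator A \<in> borel_measurable (F s)" "AE w in M. \<bar>indicator A w :: real\<bar> \<le> 1"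
      using that by (auto simp: indicator_def)
    have "(\<lambda>t. expectation (\<lambda>w. indicator A w * m t w)) \<longlonglongrightarrow> expectation (\<lambda>w. indicator A w * Z w)"
    proof (rule integral_dominated_convergence[where w = "\<lambda>_. C"])
      show "AE w in M. (\<lambda>t. indicator A w * m t w) \<longlonglongrightarrow> indicator A w * Z w"
        using lim by eventually_elim (intro tendsto_intros)
      show "AE w in M. norm (indicator A w * m t w) \<le> C" for t
        using m_bounded[of t] by eventually_elim (auto simp: indicator_def)
    qed (use AM Z in auto)
    moreover have "eventually (\<lambda>t. expectation (\<lambda>w. indicator A w * m t w)
        = expectation (\<lambda>w. indicator A w * X w)) sequentially"
      using eventually_ge_at_top[of s] by eventually_elim (rule expectation_mult_m(2)[OF ind])
    ultimately have "expectation (\<lambda>w. indicator A w * Z w) = expectation (\<lambda>w. indicator A w * X w)"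
      by (rule LIMSEQ_unique[OF _ tendsto_eventually])
    then show ?thesis by (simp add: set_lebesgue_integral_def)
  qed
  have "Int_stable (\<Union>t. sets (F t))"
  proof (rule Int_stableI)
    fix a b assume "a \<in> (\<Union>t. sets (F t))" "b \<in> (\<Union>t. sets (F t))"
    then obtain s t where "a \<in> sets (F s)" "b \<in> sets (F t)" by auto
    then have "a \<in> sets (F (max s t))" "b \<in> sets (F (max s t))"
      using mono[of s "max s t"] mono[of t "max s t"] by auto
    then show "a \<inter> b \<in> (\<Union>t. sets (F t))" by auto
  qed
  from this sets_F_subset A[unfolded sets_F_infinity] show ?thesis
  proof (induction rule: sigma_sets_induct_disjoint)
    case (basic A)
    then show ?case using \<open>\<And>A s. A \<in> sets (F s) \<Longrightarrow> _\<close> by auto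
  next
    case empty
    then show ?case by (simp add: set_lebesgue_integral_def)
  next
    case (compl A)
    have top: "space M \<in> sets (F 0)" using sets.top[of "F 0"] by (simp add: space_F)
    then have topS: "space M \<in> sigma_sets (space M) (\<Union>t. sets (F t))" by auto
    have diff: "(\<integral>w\<in>space M - A. f w \<partial>M) = (\<integral>w\<in>space M. f w \<partial>M) - (\<integral>w\<in>A. f w \<partial>M)"
      if "set_integrable M (space M - A) f" "set_integrable M A f" for f :: "'w \<Rightarrow> real"
      using set_integral_Un[of "space M - A" A M f] that sets.sets_into_space[OF events[OF compl(1)]]
      by (simp add: Un_absorb2 Diff_disjoint Int_commute)
    show ?case using si[OF compl(1)] si[OF sigma_sets.Compl[OF compl(1)]] compl(2) basic[OF top]
      by (simp add: diff)
  next
    case (union A)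
    have U: "(\<Union>i. A i) \<in> sigma_sets (space M) (\<Union>t. sets (F t))"
      using union(2) by (intro sigma_sets.Union) auto
    have "(\<integral>w\<in>(\<Union>i. A i). f w \<partial>M) = (\<Sum>i. \<integral>w\<in>A i. f w \<partial>M)"
      if "set_integrable M (\<Union>i. A i) f" for f :: "'w \<Rightarrow> real"
      using union(1,2) that by (intro lebesgue_integral_countable_add events) (auto simp: disjoint_family_on_def)
    then show ?case using si[OF U] union(3) by simp
  qed
qed

text \<open>
  Levy's upward theorem: the almost sure limit exists by the Cauchy property, and it is the
  conditional expectation because it is measurable for the limit algebra and has the right integrals.
\<close>
theorem levy_upward: "AE w in M. (\<lambda>t. m t w) \<longlonglongrightarrow> real_cond_exp M F_inf X w"
proof -
  interpret Finf: finite_measure_subalgebra M F_inf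
    using sub_infinity by unfold_locales
  define Z where "Z w = lim (\<lambda>t. m t w)" for w
  have lim: "AE w in M. (\<lambda>t. m t w) \<longlonglongrightarrow> Z w"
    using AE_Cauchy by eventually_elim (simp add: Z_def Cauchy_convergent convergent_LIMSEQ_iff[symmetric])
  have "subalgebra F_inf (F t)" for t
    by (auto simp: subalgebra_def space_F sets_F_infinity space_F_infinity)
  then have "m t \<in> borel_measurable F_inf" for t
    by (rule measurable_from_subalg[OF _ m_adapted[OF order_refl]])
  then have ZF: "Z \<in> borel_measurable F_inf"
    unfolding Z_def by (rule borel_measurable_lim_metric)
  have bd: "AE w in M. \<forall>t. \<bar>m t w\<bar> \<le> C" unfolding AE_all_countable using m_bounded by auto
  have "AE w in M. norm (Z w) \<le> C"
    using lim bd
  proof eventually_elim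
    case (elim w)
    then show ?case by (intro LIMSEQ_le_const2[OF tendsto_norm[OF elim(1)]]) auto
  qed
  then have Z: "integrable M Z"
    using measurable_from_subalg[OF sub_infinity ZF] by (intro integrable_const_bound[of _ C])
  have "AE w in M. real_cond_exp M F_inf X w = Z w"
    by (intro Finf.real_cond_exp_charact set_integral_limit_eq lim Z integrable_X ZF)
  then show ?thesis using lim by eventually_elim simp
qed

end

section \<open>Weak convergence tested on countably many open sets\<close>

text \<open>
  The finite unions of members of a countable basis. Closure under finite unions is what lets an open
  set be exhausted by an increasing sequence, so that its measure is determined by continuity from below.
\<close>
lemma countable_open_union_basis:
  obtains \<U> :: "'a::second_countable_topology set set"
  where "countable \<U>" "\<And>U. U \<in> \<U> \<Longrightarrow> open U"
    "\<And>V. open V \<Longrightarrow> \<exists>W::nat \<Rightarrow> 'a set. range W \<subseteq> \<U> \<and> incseq W \<and> (\<Union>k. W k) = V"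
proof -
  obtain \<B> :: "'a set set" where \<B>: "countable \<B>" "topological_basis \<B>"
    using ex_countable_basis by blast
  define \<U> where "\<U> = Union ` {\<C>. finite \<C> \<and> \<C> \<subseteq> \<B>}"
  show thesis
  proof
    show "countable \<U>" unfolding \<U>_def
      using countable_Collect_finite_subset[OF \<B>(1)] by (rule countable_image)
    show "open U" if "U \<in> \<U>" for U
      using that \<B>(2) by (auto simp: \<U>_def topological_basis_open intro!: open_Union)
    show "\<exists>W::nat \<Rightarrow> 'a set. range W \<subseteq> \<U> \<and> incseq W \<and> (\<Union>k. W k) = V" if V: "open V" for V
    proof -
      obtain \<C> where \<C>: "\<C> \<subseteq> \<B>" "\<Union>\<C> = V"
        using \<B>(2) V unfolding topological_basis_def by meson
      then have "countable (insert {} \<C>)" using \<B>(1) by (auto intro: countable_subset)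
      then obtain c :: "nat \<Rightarrow> 'a set" where c: "range c = insert {} \<C>"
        using uncountable_def[of "insert {} \<C>"] by auto
      \<comment> \<open>The empty set was added to have an enumeration even of an empty \<open>\<C>\<close>. It need not be a
        basis set, so it is left out of the unions.\<close>
      define W where "W k = \<Union>((c ` {..<k}) - {{}})" for k
      have "W k \<in> \<U>" for k
        unfolding \<U>_def W_def using c \<C>(1) by (intro image_eqI[OF refl]) auto
      moreover have "incseq W" by (force simp: incseq_def W_def)
      moreover have "(\<Union>k. W k) = \<Union>(range c)" by (fastforce simp: W_def)
      ultimately show ?thesis using c \<C>(2) by (intro exI[of _ W]) auto
    qed
  qed
qed

text \<open>
  One member \<open>W k\<close> of the exhaustion of \<open>V\<close> already has more than mass \<open>c\<close> under the limit, and the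
  measures \<open>\<mu> t\<close> give \<open>V\<close> at least the mass of \<open>W k\<close>.
\<close>
lemma open_set_liminf:
  fixes \<mu> :: "nat \<Rightarrow> 'a::second_countable_topology measure"
  assumes \<U>: "\<And>U. U \<in> \<U> \<Longrightarrow> open U"
    "\<And>V. open V \<Longrightarrow> \<exists>W::nat \<Rightarrow> 'a set. range W \<subseteq> \<U> \<and> incseq W \<and> (\<Union>k. W k) = V"
    and \<mu>: "\<And>t. prob_space (\<mu> t)" "\<And>t. sets (\<mu> t) = sets borel"
    and \<mu>': "prob_space \<mu>'" "sets \<mu>' = sets borel"
    and conv: "\<And>U. U \<in> \<U> \<Longrightarrow> (\<lambda>t. measure (\<mu> t) U) \<longlonglongrightarrow> measure \<mu>' U"
    and V: "open V" and c: "c < measure \<mu>' V"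
  shows "eventually (\<lambda>t. c < measure (\<mu> t) V) sequentially"
proof -
  interpret \<mu>': prob_space \<mu>' by fact
  obtain W :: "nat \<Rightarrow> 'a set" where W: "range W \<subseteq> \<U>" "incseq W" "(\<Union>k. W k) = V"
    using \<U>(2)[OF V] by blast
  have Wo: "open (W k)" for k using W(1) \<U>(1) by auto
  have "(\<lambda>k. measure \<mu>' (W k)) \<longlonglongrightarrow> measure \<mu>' V"
    unfolding W(3)[symmetric] using Wo W(2) by (intro \<mu>'.finite_Lim_measure_incseq) (auto simp: \<mu>'(2))
  from order_tendstoD(1)[OF this c] obtain k where k: "c < measure \<mu>' (W k)"
    by (auto simp: eventually_sequentially)
  have "W k \<in> \<U>" using W(1) by auto
  then have "eventually (\<lambda>t. c < measure (\<mu> t) (W k)) sequentially"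
    using order_tendstoD(1)[OF conv k] by auto
  then show ?thesis
  proof eventually_elim
    case (elim t)
    interpret prob_space "\<mu> t" by (rule \<mu>)
    have "measure (\<mu> t) (W k) \<le> measure (\<mu> t) V"
      using W(3) V by (intro finite_measure_mono) (auto simp: \<mu>)
    then show ?case using elim by simp
  qed
qed

text \<open>
  One direction of the portmanteau theorem. For a bounded continuous \<open>f\<close> the image measures on the line
  converge in distribution: the sets \<open>{f < x}\<close> and \<open>{x < f}\<close> are open, which bounds the distribution
  functions from below and from above, and at a continuity point of the limit distribution function
  the two bounds meet. The integral of \<open>f\<close> is then the integral of a truncated identity.
\<close>
lemma weakly_converges_if_open_liminf:
  fixes \<mu> :: "nat \<Rightarrow> 'a::topological_space measure"
  assumes \<mu>: "\<And>t. prob_space (\<mu> t)" "\<And>t. sets (\<mu> t) = sets borel"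
    and \<mu>': "prob_space \<mu>'" "sets \<mu>' = sets borel"
    and lower: "\<And>V c. open V \<Longrightarrow> c < measure \<mu>' V \<Longrightarrow>
      eventually (\<lambda>t. c < measure (\<mu> t) V) sequentially"
  shows "weakly_converges \<mu> \<mu>'"
  unfolding weakly_converges_def
proof (intro allI impI)
  fix f :: "'a \<Rightarrow> real"
  assume f: "continuous_on UNIV f" and bd: "bounded (range f)"
  obtain B where B: "\<And>x. \<bar>f x\<bar> \<le> B" using bd by (auto simp: bounded_iff)
  have fm [measurable]: "f \<in> borel_measurable borel" using f by (rule borel_measurable_continuous_onI)
  have fm': "f \<in> borel_measurable \<mu>'" "\<And>t. f \<in> borel_measurable (\<mu> t)"
    using fm \<mu>(2) \<mu>'(2) by (auto cong: measurable_cong_sets)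
  have sp: "space \<mu>' = UNIV" "\<And>t. space (\<mu> t) = UNIV"
    using sets_eq_imp_space_eq[OF \<mu>(2)] sets_eq_imp_space_eq[OF \<mu>'(2)] by auto
  interpret \<mu>': prob_space \<mu>' by fact
  interpret \<mu>: prob_space "\<mu> t" for t by (rule \<mu>)
  let ?N = "\<lambda>t. distr (\<mu> t) borel f" and ?N' = "distr \<mu>' borel f"
  interpret N': real_distribution ?N'
    by (rule \<mu>'.real_distribution_distr[OF fm'(1)])
  interpret N: real_distribution "?N t" for t
    by (rule \<mu>.real_distribution_distr[OF fm'(2)])
  have cdf: "cdf ?N' x = measure \<mu>' {y. f y \<le> x}" "cdf (?N t) x = measure (\<mu> t) {y. f y \<le> x}" for t x
    using fm' by (auto simp: cdf_def measure_distr sp vimage_def)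
  have opens: "open {y. f y < x}" "open {y. x < f y}" for x
    using f by (auto intro: open_Collect_less)
  have compl: "measure \<mu>' {y. f y \<le> x} = 1 - measure \<mu>' {y. x < f y}"
    "measure (\<mu> t) {y. f y \<le> x} = 1 - measure (\<mu> t) {y. x < f y}" for t x
    using \<mu>'.prob_compl[of "{y. x < f y}"] \<mu>.prob_compl[of "{y. x < f y}" t] opens[of x]
    by (auto simp: \<mu>' \<mu> sp Compl_eq_Diff_UNIV[symmetric] Collect_neg_eq[symmetric] not_less)
  have "weak_conv_m ?N ?N'"
    unfolding weak_conv_m_def weak_conv_def
  proof (intro allI impI)
    fix x assume "isCont (cdf ?N') x"
    then have "measure ?N' {x} = 0" using N'.isCont_cdf by simp
    then have null: "measure \<mu>' {y. f y = x} = 0"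
      using fm' by (simp add: measure_distr sp vimage_def)
    have eq: "{y. f y \<le> x} = {y. f y < x} \<union> {y. f y = x}" by auto
    have meas: "{y. f y < x} \<in> sets \<mu>'" "{y. f y = x} \<in> sets \<mu>'"
      "{y. f y \<le> x} \<in> sets (\<mu> t)" "{y. f y < x} \<in> sets (\<mu> t)" for t
      using \<mu>(2) \<mu>'(2) by auto
    have lt: "measure \<mu>' {y. f y \<le> x} = measure \<mu>' {y. f y < x}"
      unfolding eq using meas null by (subst \<mu>'.finite_measure_Union) auto
    show "(\<lambda>t. cdf (?N t) x) \<longlonglongrightarrow> cdf ?N' x"
    proof (rule order_tendstoI)
      fix a assume "a < cdf ?N' x"
      then have "eventually (\<lambda>t. a < measure (\<mu> t) {y. f y < x}) sequentially"
        using lower[OF opens(1)] by (simp add: cdf lt)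
      then show "eventually (\<lambda>t. a < cdf (?N t) x) sequentially"
      proof eventually_elim
        case (elim t)
        have "measure (\<mu> t) {y. f y < x} \<le> measure (\<mu> t) {y. f y \<le> x}"
          using meas by (intro \<mu>.finite_measure_mono) auto
        then show ?case using elim by (simp add: cdf)
      qed
    next
      fix a assume "cdf ?N' x < a"
      then have "1 - a < measure \<mu>' {y. x < f y}" by (simp add: cdf compl)
      then show "eventually (\<lambda>t. cdf (?N t) x < a) sequentially"
        using lower[OF opens(2)] by (fastforce simp: cdf compl elim: eventually_mono)
    qed
  qed
  \<comment> \<open>The identity truncated to the range of \<open>f\<close>, a bounded continuous test function on the line.\<close>
  define g where "g x = max (- B) (min B x)" for x :: real
  have "\<bar>g x\<bar> \<le> \<bar>B\<bar>" for x by (auto simp: g_def)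
  moreover have "isCont g x" for x unfolding g_def by (intro continuous_intros)
  ultimately have "(\<lambda>t. integral\<^sup>L (?N t) g) \<longlonglongrightarrow> integral\<^sup>L ?N' g"
    using weak_conv_imp_integral_bdd_continuous_conv[of ?N ?N' g "\<bar>B\<bar>"]
      \<open>weak_conv_m ?N ?N'\<close> N.real_distribution_axioms N'.real_distribution_axioms by simp
  moreover have "g (f x) = f x" for x using B[of x] by (auto simp: g_def)
  moreover have "g \<in> borel_measurable borel" unfolding g_def by measurable
  ultimately show "(\<lambda>t. integral\<^sup>L (\<mu> t) f) \<longlonglongrightarrow> integral\<^sup>L \<mu>' f"
    using fm' by (simp add: integral_distr)
qed

lemma weakly_converges_if_convergence_on_union_basis:
  fixes \<mu> :: "nat \<Rightarrow> 'a::second_countable_topology measure"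
  assumes "\<And>U. U \<in> \<U> \<Longrightarrow> open U"
    "\<And>V. open V \<Longrightarrow> \<exists>W::nat \<Rightarrow> 'a set. range W \<subseteq> \<U> \<and> incseq W \<and> (\<Union>k. W k) = V"
    "\<And>t. prob_space (\<mu> t)" "\<And>t. sets (\<mu> t) = sets borel"
    "prob_space \<mu>'" "sets \<mu>' = sets borel"
    "\<And>U. U \<in> \<U> \<Longrightarrow> (\<lambda>t. measure (\<mu> t) U) \<longlonglongrightarrow> measure \<mu>' U"
  shows "weakly_converges \<mu> \<mu>'"
  using open_set_liminf[OF assms] by (intro weakly_converges_if_open_liminf assms)

text \<open>
  The lower bound on open sets, applied to constant sequences in both directions, gives equality on
  all open sets.
\<close>
lemma measure_eq_if_eq_on_union_basis:
  fixes \<mu> \<mu>' :: "'a::second_countable_topology measure"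
  assumes \<U>: "\<And>U. U \<in> \<U> \<Longrightarrow> open U"
    "\<And>V. open V \<Longrightarrow> \<exists>W::nat \<Rightarrow> 'a set. range W \<subseteq> \<U> \<and> incseq W \<and> (\<Union>k. W k) = V"
    and \<mu>: "prob_space \<mu>" "sets \<mu> = sets borel"
    and \<mu>': "prob_space \<mu>'" "sets \<mu>' = sets borel"
    and eq: "\<And>U. U \<in> \<U> \<Longrightarrow> measure \<mu> U = measure \<mu>' U"
  shows "\<mu> = \<mu>'"
proof -
  interpret \<mu>: prob_space \<mu> by fact
  interpret \<mu>': prob_space \<mu>' by fact
  have "c < measure \<mu> V" if "open V" "c < measure \<mu>' V" for V c
    using open_set_liminf[OF \<U>, of "\<lambda>_. \<mu>" \<mu>' V c] that eq \<mu> \<mu>' by simp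
  moreover have "c < measure \<mu>' V" if "open V" "c < measure \<mu> V" for V c
    using open_set_liminf[OF \<U>, of "\<lambda>_. \<mu>'" \<mu> V c] that eq \<mu> \<mu>' by simp
  ultimately have open_eq: "measure \<mu> V = measure \<mu>' V" if "open V" for V
    using that by (meson less_irrefl linorder_neqE_linordered_idom)
  show ?thesis
  proof (rule measure_eqI_generator_eq[where \<Omega> = UNIV and E = "Collect open" and A = "\<lambda>_. UNIV"])
    show "Int_stable (Collect open :: 'a set set)" by (auto simp: Int_stable_def)
  qed (auto simp: \<mu> \<mu>' sets_borel \<mu>.emeasure_eq_measure \<mu>'.emeasure_eq_measure open_eq)
qed

section \<open>Information and conditional laws in the sampling model\<close>

lemma generated_algebra_generator_subset:
  "{X -` A \<inter> space M | X A. X \<in> \<X> \<and> A \<in> sets borel} \<subseteq> Pow (space M)"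
  by auto

lemma space_generated_algebra: "space (generated_algebra M \<X>) = space M"
  unfolding generated_algebra_def by (rule space_measure_of[OF generated_algebra_generator_subset])

lemma sets_generated_algebra:
  "sets (generated_algebra M \<X>) =
    sigma_sets (space M) {X -` A \<inter> space M | X A. X \<in> \<X> \<and> A \<in> sets borel}"
  unfolding generated_algebra_def by (rule sets_measure_of[OF generated_algebra_generator_subset])

lemma generated_algebra_mono:
  "\<X> \<subseteq> \<Y> \<Longrightarrow> sets (generated_algebra M \<X>) \<subseteq> sets (generated_algebra M \<Y>)"
  unfolding sets_generated_algebra by (intro sigma_sets_mono') blast

lemma subalgebra_generated_algebra:
  assumes "\<And>X. X \<in> \<X> \<Longrightarrow> X \<in> borel_measurable M"
  shows "subalgebra M (generated_algebra M \<X>)"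
  using assms unfolding subalgebra_def space_generated_algebra sets_generated_algebra
  by (auto intro!: sets.sigma_sets_subset)

lemma measurable_generated_algebra:
  "X \<in> \<X> \<Longrightarrow> X \<in> borel_measurable (generated_algebra M \<X>)"
  by (rule measurableI) (auto simp: space_generated_algebra sets_generated_algebra)

lemma regular_cond_law_measurable:
  assumes "regular_cond_law M F X K" "A \<in> sets borel"
  shows "(\<lambda>w. measure (K w) A) \<in> borel_measurable F"
  using assms measurable_compose[OF _ measurable_measure_prob_algebra]
  unfolding regular_cond_law_def by blast

lemma regular_cond_law_prob_space:
  assumes "regular_cond_law M F X K" "subalgebra M F" "w \<in> space M"
  shows "prob_space (K w)" "sets (K w) = sets borel"
  using assms measurable_space[of K F "prob_algebra borel" w]
  unfolding regular_cond_law_def subalgebra_def by (auto simp: space_prob_algebra)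

lemma regular_cond_law_bounded:
  assumes "regular_cond_law M F X K" "subalgebra M F"
  shows "AE w in M. \<bar>measure (K w) A\<bar> \<le> 1"
proof (rule AE_I2)
  fix w assume "w \<in> space M"
  then interpret prob_space "K w" using assms by (intro regular_cond_law_prob_space)
  show "\<bar>measure (K w) A\<bar> \<le> 1" by simp
qed

text \<open>
  The form in which all conditional laws of the model are used: against a bounded variable known to
  \<open>F\<close>, the indicator of \<open>X \<in> A\<close> can be replaced by its conditional probability, and conversely.
\<close>
lemma (in prob_space) expectation_mult_regular_cond_law:
  fixes h :: "'a \<Rightarrow> real"
  assumes law: "regular_cond_law M F X K" and sub: "subalgebra M F"
    and X: "X \<in> borel_measurable M" and A: "A \<in> sets borel"
    and h: "h \<in> borel_measurable F" "AE w in M. \<bar>h w\<bar> \<le> D"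
  shows "expectation (\<lambda>w. h w * indicator A (X w)) = expectation (\<lambda>w. h w * measure (K w) A)"
proof -
  interpret F: finite_measure_subalgebra M F
    using sub by unfold_locales
  let ?I = "indicator (X -` A \<inter> space M) :: 'a \<Rightarrow> real"
  have hM [measurable]: "h \<in> borel_measurable M" using h(1) measurable_from_subalg[OF sub] by blast
  have IM [measurable]: "?I \<in> borel_measurable M" using X A by (auto intro: measurable_sets)
  have "AE w in M. \<bar>h w * ?I w\<bar> \<le> \<bar>D\<bar>" using h(2) by eventually_elim (auto simp: indicator_def)
  then have int: "integrable M (\<lambda>w. h w * ?I w)" by (intro integrable_const_bound[of _ "\<bar>D\<bar>"]) auto
  have "expectation (\<lambda>w. h w * indicator A (X w)) = expectation (\<lambda>w. h w * ?I w)"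
    by (intro Bochner_Integration.integral_cong) (auto simp: indicator_def)
  also have "\<dots> = expectation (\<lambda>w. h w * real_cond_exp M F ?I w)"
    by (rule F.real_cond_exp_intg(2)[OF int h(1) IM, symmetric])
  also have "\<dots> = expectation (\<lambda>w. h w * measure (K w) A)"
  proof (rule integral_cong_AE)
    show "AE w in M. h w * real_cond_exp M F ?I w = h w * measure (K w) A"
      using law A unfolding regular_cond_law_def by (auto elim: eventually_mono)
    show "(\<lambda>w. h w * measure (K w) A) \<in> borel_measurable M"
      using measurable_from_subalg[OF sub regular_cond_law_measurable[OF law A]] by measurable
  qed measurable
  finally show ?thesis .
qed

context sampling_model
begin

lemma neighbors_verts: "j \<in> neighbors G i \<Longrightarrow> j \<in> {1..n}"
  using adj_in_verts[of i j] verts_eq by (auto simp: neighbors_def)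

lemma subalgebra_agent_info:
  "i \<in> {1..n} \<Longrightarrow> subalgebra M (agent_info M G S Y i t)"
  unfolding agent_info_def using signal_measurable sample_measurable neighbors_verts
  by (intro subalgebra_generated_algebra) auto

lemma agent_info_mono:
  "s \<le> t \<Longrightarrow> sets (agent_info M G S Y i s) \<subseteq> sets (agent_info M G S Y i t)"
  unfolding agent_info_def
  by (intro generated_algebra_mono Un_mono subset_refl) (blast intro: less_le_trans)

lemma subalgebra_global_info: "subalgebra M (global_info M {1..n} \<theta> S Y t)"
  unfolding global_info_def using state_measurable signal_measurable sample_measurable
  by (intro subalgebra_generated_algebra) auto

lemma subalgebra_global_agent_info:
  assumes "i \<in> {1..n}"
  shows "subalgebra (global_info M {1..n} \<theta> S Y t) (agent_info M G S Y i t)"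
  unfolding subalgebra_def agent_info_def global_info_def space_generated_algebra
  using assms neighbors_verts by (intro conjI refl generated_algebra_mono) auto

text \<open>
  The information of an agent starts at time \<open>1\<close>, the filtration of a martingale at index \<open>0\<close>.
\<close>
lemma agent_info_limit_eq:
  "agent_info_limit M G S Y i = sigma (space M) (\<Union>t. sets (agent_info M G S Y i (Suc t)))"
proof -
  have "{1..} = range Suc" by (auto simp: image_iff Suc_le_D le_eq_less_or_eq gr0_conv_Suc)
  then have "(\<Union>t\<in>{1..}. sets (agent_info M G S Y i t)) = (\<Union>t. sets (agent_info M G S Y i (Suc t)))"
    by (simp only: image_image UN_simps)
  then show ?thesis by (simp add: agent_info_limit_def)
qed

lemma posterior_martingale:
  assumes "i \<in> {1..n}" "A \<in> sets borel"
  shows "bounded_doob_martingale M (\<lambda>t. agent_info M G S Y i (Suc t)) (indicator (\<theta> -` A \<inter> space M)) 1"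
proof
  show "indicator (\<theta> -` A \<inter> space M) \<in> borel_measurable M"
    using assms state_measurable by (auto intro: measurable_sets)
qed (use assms agent_info_mono in \<open>auto simp: subalgebra_agent_info indicator_def\<close>)

lemma subalgebra_agent_info_limit:
  assumes "i \<in> {1..n}"
  shows "subalgebra M (agent_info_limit M G S Y i)"
  \<comment> \<open>Any event serves here, since only facts about the filtration are taken from the martingale.\<close>
  using bounded_doob_martingale.sub_infinity[OF posterior_martingale[OF assms, of "{}"]]
  by (simp add: agent_info_limit_eq)

lemma subalgebra_agent_info_limit_agent_info:
  assumes "i \<in> {1..n}"
  shows "subalgebra (agent_info_limit M G S Y i) (agent_info M G S Y i (Suc t))"
proof -
  interpret bounded_doob_martingale M "\<lambda>t. agent_info M G S Y i (Suc t)" "indicator (\<theta> -` {} \<inter> space M)" 1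
    by (rule posterior_martingale[OF assms]) simp
  show ?thesis unfolding agent_info_limit_eq
    by (auto simp: subalgebra_def space_F sets_F_infinity space_F_infinity)
qed

section \<open>Convergence of the posteriors\<close>

lemma posterior_converges_on_event:
  assumes i: "i \<in> {1..n}" and A: "A \<in> sets borel"
    and L: "regular_cond_law M (agent_info_limit M G S Y i) \<theta> L"
  shows "AE w in M. (\<lambda>t. measure (post i t w) A) \<longlonglongrightarrow> measure (L w) A"
proof -
  let ?m = "\<lambda>t. real_cond_exp M (agent_info M G S Y i (Suc t)) (indicator (\<theta> -` A \<inter> space M))"
  have "AE w in M. \<forall>t. measure (post i (Suc t) w) A = ?m t w"
    unfolding AE_all_countable using posterior[OF i] A unfolding regular_cond_law_def by auto
  moreover have "AE w in M. measure (L w) A =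
      real_cond_exp M (agent_info_limit M G S Y i) (indicator (\<theta> -` A \<inter> space M)) w"
    using L A unfolding regular_cond_law_def by auto
  moreover have "AE w in M. (\<lambda>t. ?m t w) \<longlonglongrightarrow>
      real_cond_exp M (agent_info_limit M G S Y i) (indicator (\<theta> -` A \<inter> space M)) w"
    using bounded_doob_martingale.levy_upward[OF posterior_martingale[OF i A]]
    by (simp add: agent_info_limit_eq)
  ultimately show ?thesis
  proof eventually_elim
    case (elim w)
    show ?case by (rule LIMSEQ_imp_Suc) (use elim in simp)
  qed
qed

text \<open>
  The null set of the convergence on a fixed event depends on the event. Countably many open sets
  suffice for weak convergence, so one null set is enough.
\<close>
lemma posterior_converges_weakly:
  assumes i: "i \<in> {1..n}" and L: "regular_cond_law M (agent_info_limit M G S Y i) \<theta> L"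
  shows "AE w in M. weakly_converges (\<lambda>t. post i t w) (L w)"
proof -
  obtain \<U> :: "(real ^ 'd) set set" where \<U>: "countable \<U>" "\<And>U. U \<in> \<U> \<Longrightarrow> open U"
    "\<And>V. open V \<Longrightarrow> \<exists>W::nat \<Rightarrow> (real ^ 'd) set. range W \<subseteq> \<U> \<and> incseq W \<and> (\<Union>k. W k) = V"
    using countable_open_union_basis by metis
  have "AE w in M. \<forall>U\<in>\<U>. (\<lambda>t. measure (post i t w) U) \<longlonglongrightarrow> measure (L w) U"
    using \<U>(2) posterior_converges_on_event[OF i _ L] by (intro AE_ball_countable'[OF _ \<U>(1)]) auto
  then show ?thesis
    using AE_space
  proof eventually_elim
    case (elim w)
    \<comment> \<open>The value of \<open>post i\<close> at time \<open>0\<close> is arbitrary and need not be a probability measure.\<close>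
    have "weakly_converges (\<lambda>t. post i (Suc t) w) (L w)"
    proof (rule weakly_converges_if_convergence_on_union_basis[OF \<U>(2,3)])
      show "prob_space (post i (Suc t) w)" "sets (post i (Suc t) w) = sets borel" for t
        using regular_cond_law_prob_space[OF posterior[OF i] subalgebra_agent_info[OF i] elim(2)]
        by auto
      show "prob_space (L w)" "sets (L w) = sets borel"
        using regular_cond_law_prob_space[OF L subalgebra_agent_info_limit[OF i] elim(2)] by auto
      show "(\<lambda>t. measure (post i (Suc t) w) U) \<longlonglongrightarrow> measure (L w) U" if "U \<in> \<U>" for U
        by (rule LIMSEQ_Suc) (use elim(1) that in auto)
    qed
    show ?case
      unfolding weakly_converges_def
    proof (intro allI impI)
      fix f :: "real ^ 'd \<Rightarrow> real"
      assume "continuous_on UNIV f" "bounded (range f)"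
      with \<open>weakly_converges _ _\<close> show "(\<lambda>t. integral\<^sup>L (post i t w) f) \<longlonglongrightarrow> integral\<^sup>L (L w) f"
        unfolding weakly_converges_def by (intro LIMSEQ_imp_Suc[of "\<lambda>t. integral\<^sup>L (post i t w) f"]) blast
    qed
  qed
qed

section \<open>Agreement of neighbors\<close>

text \<open>
  Let \<open>p i t\<close> and \<open>p j t\<close> be the posterior probabilities of \<open>A\<close>, with limits \<open>q\<close> and \<open>r\<close>. The expectation
  of \<open>q\<close> times the indicator of \<open>Y j t \<in> A\<close> is found in two ways. Exactly: agent \<open>i\<close> eventually sees the
  sample, so \<open>q\<close> may be replaced by the indicator of \<open>\<theta> \<in> A\<close>; given the past, which includes \<open>\<theta>\<close>, the
  sample has the law \<open>post j t\<close>; and \<open>p j t\<close> is the conditional probability of \<open>\<theta> \<in> A\<close>. The result is the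
  expectation of \<open>(p j t)\<^sup>2\<close>. Asymptotically: \<open>q\<close> is close to \<open>p i t\<close>, which belongs to the past, so the
  sample may again be replaced by its law. The result is the expectation of \<open>p i t * p j t\<close>. The detour
  through \<open>p i t\<close> is needed because \<open>q\<close> may depend on the sample.
\<close>
lemma neighbor_limit_second_moment:
  assumes i: "i \<in> {1..n}" and ij: "j \<in> neighbors G i" and A: "A \<in> sets borel"
    and L: "regular_cond_law M (agent_info_limit M G S Y i) \<theta> L"
    and K: "regular_cond_law M (agent_info_limit M G S Y j) \<theta> K"
  shows "expectation (\<lambda>w. measure (L w) A * measure (K w) A) = expectation (\<lambda>w. (measure (K w) A)\<^sup>2)"
proof -
  have j: "j \<in> {1..n}" using ij by (rule neighbors_verts)
  define p where "p i t w = measure (post i t w) A" for i t w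
  define q where "q w = measure (L w) A" for w
  define r where "r w = measure (K w) A" for w
  let ?y = "\<lambda>t w. indicator A (Y j (Suc t) w) :: real"
  have p_meas: "p k (Suc t) \<in> borel_measurable (agent_info M G S Y k (Suc t))"
    and p_global: "p k (Suc t) \<in> borel_measurable (global_info M {1..n} \<theta> S Y (Suc t))"
    and p_M: "p k (Suc t) \<in> borel_measurable M"
    and p_bd: "AE w in M. \<bar>p k (Suc t) w\<bar> \<le> 1" if "k \<in> {1..n}" for k t
  proof -
    note law = posterior[OF that, of "Suc t", simplified]
    show 1: "p k (Suc t) \<in> borel_measurable (agent_info M G S Y k (Suc t))"
      unfolding p_def by (rule regular_cond_law_measurable[OF law A])
    show "p k (Suc t) \<in> borel_measurable (global_info M {1..n} \<theta> S Y (Suc t))"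
      by (rule measurable_from_subalg[OF subalgebra_global_agent_info[OF that] 1])
    show "p k (Suc t) \<in> borel_measurable M"
      by (rule measurable_from_subalg[OF subalgebra_agent_info[OF that] 1])
    show "AE w in M. \<bar>p k (Suc t) w\<bar> \<le> 1"
      unfolding p_def by (rule regular_cond_law_bounded[OF law subalgebra_agent_info[OF that]])
  qed
  have q_M: "q \<in> borel_measurable M" and r_M: "r \<in> borel_measurable M"
    unfolding q_def r_def
    by (rule measurable_from_subalg[OF _ regular_cond_law_measurable[OF _ A]]
        subalgebra_agent_info_limit i j L K)+
  have q_bd: "AE w in M. \<bar>q w\<bar> \<le> 1" and r_bd: "AE w in M. \<bar>r w\<bar> \<le> 1"
    unfolding q_def r_def
    by (rule regular_cond_law_bounded subalgebra_agent_info_limit i j L K)+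
  have Y_M: "Y j (Suc t) \<in> borel_measurable M" for t using sample_measurable[OF j] by simp
  have y_M: "?y t \<in> borel_measurable M" for t using Y_M A by measurable
  have y_info: "?y t \<in> borel_measurable (agent_info_limit M G S Y i)" for t
  proof -
    have "Y j (Suc t) \<in> borel_measurable (agent_info M G S Y i (Suc (Suc t)))"
      unfolding agent_info_def using ij by (intro measurable_generated_algebra) auto
    then have "Y j (Suc t) \<in> borel_measurable (agent_info_limit M G S Y i)"
      by (rule measurable_from_subalg[OF subalgebra_agent_info_limit_agent_info[OF i]])
    then show ?thesis using A by measurable
  qed
  have \<theta>_global: "(\<lambda>w. indicator A (\<theta> w) :: real) \<in> borel_measurable (global_info M {1..n} \<theta> S Y t)" for t
  proof -
    have "\<theta> \<in> borel_measurable (global_info M {1..n} \<theta> S Y t)"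
      unfolding global_info_def by (intro measurable_generated_algebra) auto
    then show ?thesis using A by measurable
  qed
  have ind_bd: "AE w in M. \<bar>indicator A (f w) :: real\<bar> \<le> 1" for f :: "'w \<Rightarrow> real ^ 'd"
    by (auto simp: indicator_def)
  have sample: "expectation (\<lambda>w. h w * ?y t w) = expectation (\<lambda>w. h w * p j (Suc t) w)"
    if "h \<in> borel_measurable (global_info M {1..n} \<theta> S Y (Suc t))" "AE w in M. \<bar>h w\<bar> \<le> 1" for h t
    unfolding p_def using sample_law[OF j, of "Suc t"]
    by (intro expectation_mult_regular_cond_law[OF _ subalgebra_global_info Y_M A that]) simp
  \<comment> \<open>One replacement for each of the three facts: \<open>i\<close> observes the sample, the sample has the
    law \<open>post j\<close> given the past, and \<open>p j\<close> is a conditional probability.\<close>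
  have limit_moment: "expectation (\<lambda>w. q w * ?y t w) = expectation (\<lambda>w. p j (Suc t) w * p j (Suc t) w)" for t
  proof -
    have "expectation (\<lambda>w. q w * ?y t w) = expectation (\<lambda>w. ?y t w * q w)"
      by (simp add: mult.commute)
    also have "\<dots> = expectation (\<lambda>w. ?y t w * indicator A (\<theta> w))"
      unfolding q_def
      by (rule expectation_mult_regular_cond_law[OF L subalgebra_agent_info_limit[OF i]
          state_measurable A y_info ind_bd, symmetric])
    also have "\<dots> = expectation (\<lambda>w. indicator A (\<theta> w) * ?y t w)"
      by (simp add: mult.commute)
    also have "\<dots> = expectation (\<lambda>w. indicator A (\<theta> w) * p j (Suc t) w)"
      by (rule sample[OF \<theta>_global ind_bd])
    also have "\<dots> = expectation (\<lambda>w. p j (Suc t) w * indicator A (\<theta> w))"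
      by (simp add: mult.commute)
    also have "\<dots> = expectation (\<lambda>w. p j (Suc t) w * p j (Suc t) w)"
      using expectation_mult_regular_cond_law[OF posterior[OF j, of "Suc t", simplified]
          subalgebra_agent_info[OF j] state_measurable A p_meas[OF j] p_bd[OF j]]
      by (simp add: p_def)
    finally show ?thesis .
  qed
  \<comment> \<open>\<open>p i\<close> is known before the sample is drawn, so the sample can be replaced by its law.\<close>
  have current_moment: "expectation (\<lambda>w. p i (Suc t) w * ?y t w) = expectation (\<lambda>w. p i (Suc t) w * p j (Suc t) w)" for t
    by (rule sample[OF p_global[OF i] p_bd[OF i]])
  have q_lim: "AE w in M. (\<lambda>t. p i (Suc t) w) \<longlonglongrightarrow> q w"
    using posterior_converges_on_event[OF i A L]
    unfolding p_def q_def by eventually_elim (rule LIMSEQ_Suc)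
  have r_lim: "AE w in M. (\<lambda>t. p j (Suc t) w) \<longlonglongrightarrow> r w"
    using posterior_converges_on_event[OF j A K]
    unfolding p_def r_def by eventually_elim (rule LIMSEQ_Suc)
  have product_lim: "(\<lambda>t. expectation (\<lambda>w. f t w * g t w)) \<longlonglongrightarrow> expectation (\<lambda>w. f' w * g' w)"
    if "AE w in M. (\<lambda>t. f t w * g t w) \<longlonglongrightarrow> f' w * g' w"
      "\<And>t. AE w in M. \<bar>f t w\<bar> \<le> 2" "\<And>t. AE w in M. \<bar>g t w\<bar> \<le> 1"
      "\<And>t. f t \<in> borel_measurable M" "\<And>t. g t \<in> borel_measurable M"
      "f' \<in> borel_measurable M" "g' \<in> borel_measurable M"
    for f g :: "nat \<Rightarrow> 'w \<Rightarrow> real" and f' g'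
  proof (rule integral_dominated_convergence[where w = "\<lambda>_. 2"])
    show "AE w in M. norm (f t w * g t w) \<le> 2" for t
      using AE_abs_mult_le[OF that(2,3)[of t]] by simp
  qed (use that in auto)
  have bd2: "AE w in M. \<bar>f w\<bar> \<le> 2" if "AE w in M. \<bar>f w\<bar> \<le> 1" for f :: "'w \<Rightarrow> real"
    using that by eventually_elim simp
  have "(\<lambda>t. expectation (\<lambda>w. (q w - p i (Suc t) w) * ?y t w)) \<longlonglongrightarrow> expectation (\<lambda>w. 0 * 0)"
  proof (rule product_lim)
    show "AE w in M. (\<lambda>t. (q w - p i (Suc t) w) * ?y t w) \<longlonglongrightarrow> 0 * 0"
      using q_lim
    proof eventually_elim
      case (elim w)
      have "(\<lambda>t. q w - p i (Suc t) w) \<longlonglongrightarrow> 0" using tendsto_diff[OF tendsto_const elim, of "q w"] by simp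
      then have "(\<lambda>t. (q w - p i (Suc t) w) * ?y t w) \<longlonglongrightarrow> 0"
        by (rule tendsto_0_le[where K = 1]) (auto simp: indicator_def)
      then show ?case by simp
    qed
    show "AE w in M. \<bar>q w - p i (Suc t) w\<bar> \<le> 2" for t
      using q_bd p_bd[OF i, of t] by eventually_elim simp
  qed (use q_M p_M[OF i] y_M ind_bd in auto)
  moreover have "expectation (\<lambda>w. (q w - p i (Suc t) w) * ?y t w)
      = expectation (\<lambda>w. p j (Suc t) w * p j (Suc t) w) - expectation (\<lambda>w. p i (Suc t) w * p j (Suc t) w)" for t
  proof -
    have "integrable M (\<lambda>w. q w * ?y t w)" "integrable M (\<lambda>w. p i (Suc t) w * ?y t w)"
      by (rule integrable_mult_AE_bounded[OF q_bd ind_bd q_M y_M]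
          integrable_mult_AE_bounded[OF p_bd[OF i] ind_bd p_M[OF i] y_M])+
    then show ?thesis by (simp add: left_diff_distrib limit_moment current_moment)
  qed
  ultimately have "(\<lambda>t. expectation (\<lambda>w. p j (Suc t) w * p j (Suc t) w)
      - expectation (\<lambda>w. p i (Suc t) w * p j (Suc t) w)) \<longlonglongrightarrow> 0" by simp
  moreover have "(\<lambda>t. expectation (\<lambda>w. p j (Suc t) w * p j (Suc t) w)
      - expectation (\<lambda>w. p i (Suc t) w * p j (Suc t) w))
    \<longlonglongrightarrow> expectation (\<lambda>w. r w * r w) - expectation (\<lambda>w. q w * r w)"
  proof (intro tendsto_diff product_lim bd2 p_bd p_M q_M r_M i j)
    show "AE w in M. (\<lambda>t. p j (Suc t) w * p j (Suc t) w) \<longlonglongrightarrow> r w * r w"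
      using r_lim by eventually_elim (intro tendsto_mult)
    show "AE w in M. (\<lambda>t. p i (Suc t) w * p j (Suc t) w) \<longlonglongrightarrow> q w * r w"
      using q_lim r_lim by eventually_elim (intro tendsto_mult)
  qed
  ultimately have "expectation (\<lambda>w. r w * r w) - expectation (\<lambda>w. q w * r w) = 0"
    by (rule LIMSEQ_unique[symmetric])
  then show ?thesis unfolding q_def r_def by (simp add: power2_eq_square)
qed

text \<open>
  Being neighbors is symmetric, so the second moment of either limit equals their mixed moment, and
  the difference of the limits has second moment \<open>0\<close>.
\<close>
lemma neighbors_agree_on_event:
  assumes i: "i \<in> {1..n}" and ij: "j \<in> neighbors G i" and A: "A \<in> sets borel"
    and L: "regular_cond_law M (agent_info_limit M G S Y i) \<theta> L"
    and K: "regular_cond_law M (agent_info_limit M G S Y j) \<theta> K"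
  shows "AE w in M. measure (L w) A = measure (K w) A"
proof -
  have j: "j \<in> {1..n}" using ij by (rule neighbors_verts)
  have ji: "i \<in> neighbors G j"
    using ij graph_symmetric by (simp add: neighbors_def)
  define q where "q w = measure (L w) A" for w
  define r where "r w = measure (K w) A" for w
  have [measurable]: "q \<in> borel_measurable M" "r \<in> borel_measurable M"
    unfolding q_def r_def
    by (rule measurable_from_subalg[OF _ regular_cond_law_measurable[OF _ A]]
        subalgebra_agent_info_limit i j L K)+
  have q_bd: "AE w in M. \<bar>q w\<bar> \<le> 1" and r_bd: "AE w in M. \<bar>r w\<bar> \<le> 1"
    unfolding q_def r_def
    by (rule regular_cond_law_bounded subalgebra_agent_info_limit i j L K)+
  have int: "integrable M (\<lambda>w. q w * q w)" "integrable M (\<lambda>w. q w * r w)"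
    "integrable M (\<lambda>w. r w * q w)" "integrable M (\<lambda>w. r w * r w)"
    by (intro integrable_mult_AE_bounded[OF q_bd q_bd] integrable_mult_AE_bounded[OF q_bd r_bd]
        integrable_mult_AE_bounded[OF r_bd q_bd] integrable_mult_AE_bounded[OF r_bd r_bd]; measurable)+
  have sq: "(q w - r w)\<^sup>2 = q w * q w - q w * r w - (r w * q w - r w * r w)" for w
    by (simp add: power2_eq_square algebra_simps)
  have intd: "integrable M (\<lambda>w. (q w - r w)\<^sup>2)"
    unfolding sq using int by auto
  have "expectation (\<lambda>w. (q w - r w)\<^sup>2) = expectation (\<lambda>w. q w * q w) - expectation (\<lambda>w. q w * r w)
      - (expectation (\<lambda>w. r w * q w) - expectation (\<lambda>w. r w * r w))"
    unfolding sq using int by (simp add: mult.commute)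
  also have "\<dots> = 0"
    using neighbor_limit_second_moment[OF i ij A L K] neighbor_limit_second_moment[OF j ji A K L]
    unfolding q_def r_def by (simp add: power2_eq_square mult.commute)
  finally have "AE w in M. (q w - r w)\<^sup>2 = 0"
    using integral_nonneg_eq_0_iff_AE[OF intd] by simp
  then show ?thesis unfolding q_def r_def by eventually_elim simp
qed

lemma neighbors_agree:
  assumes i: "i \<in> {1..n}" and ij: "j \<in> neighbors G i"
    and L: "regular_cond_law M (agent_info_limit M G S Y i) \<theta> L"
    and K: "regular_cond_law M (agent_info_limit M G S Y j) \<theta> K"
  shows "AE w in M. L w = K w"
proof -
  have j: "j \<in> {1..n}" using ij by (rule neighbors_verts)
  obtain \<U> :: "(real ^ 'd) set set" where \<U>: "countable \<U>" "\<And>U. U \<in> \<U> \<Longrightarrow> open U"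
    "\<And>V. open V \<Longrightarrow> \<exists>W::nat \<Rightarrow> (real ^ 'd) set. range W \<subseteq> \<U> \<and> incseq W \<and> (\<Union>k. W k) = V"
    using countable_open_union_basis by metis
  have "AE w in M. \<forall>U\<in>\<U>. measure (L w) U = measure (K w) U"
    using \<U>(2) neighbors_agree_on_event[OF i ij _ L K] by (intro AE_ball_countable'[OF _ \<U>(1)]) auto
  then show ?thesis
    using AE_space
  proof eventually_elim
    case (elim w)
    then show ?case
      using regular_cond_law_prob_space[OF L subalgebra_agent_info_limit[OF i] elim(2)]
        regular_cond_law_prob_space[OF K subalgebra_agent_info_limit[OF j] elim(2)]
      by (intro measure_eq_if_eq_on_union_basis[OF \<U>(2,3)]) auto
  qed
qed

lemma reachable_agree:
  assumes "i \<rightarrow>\<^sup>*\<^bsub>G\<^esub> j"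
    and L: "\<And>k. k \<in> {1..n} \<Longrightarrow> regular_cond_law M (agent_info_limit M G S Y k) \<theta> (L k)"
  shows "AE w in M. L i w = L j w"
  using assms(1)
proof (induction rule: reachable_induct)
  case (step x y)
  have "x \<in> {1..n}" "y \<in> neighbors G x"
    using step(2) adj_in_verts[of x y] verts_eq by (auto simp: neighbors_def)
  then have "AE w in M. L x w = L y w"
    using neighbors_agree L neighbors_verts by blast
  then show ?case using step(3) by eventually_elim simp
qed simp

lemma connected_reachable:
  assumes "Digraph_Component.connected G" "i \<in> {1..n}" "j \<in> {1..n}"
  shows "i \<rightarrow>\<^sup>*\<^bsub>G\<^esub> j"
proof -
  have "strongly_connected G"
    using symmetric_connected_imp_strongly_connected[OF sym_arcs assms(1)] .
  then show ?thesis using assms(2,3) verts_eq by (auto simp: strongly_connected_def)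
qed

end

theorem theorem2p1:
  fixes M :: "'w measure"
    and G :: "(nat, 'e) pre_digraph"
    and n :: nat
    and \<nu> :: "(real ^ 'd) measure"
    and P :: "nat \<Rightarrow> real ^ 'd \<Rightarrow> (real ^ 'd) measure"
    and \<theta> :: "'w \<Rightarrow> real ^ 'd"
    and S :: "nat \<Rightarrow> 'w \<Rightarrow> real ^ 'd"
    and Y :: "nat \<Rightarrow> nat \<Rightarrow> 'w \<Rightarrow> real ^ 'd"
    and post :: "nat \<Rightarrow> nat \<Rightarrow> 'w \<Rightarrow> (real ^ 'd) measure"
    and post_inf :: "nat \<Rightarrow> 'w \<Rightarrow> (real ^ 'd) measure"
  assumes "sampling_model M G n \<nu> P \<theta> S Y post"
    and "\<And>i. i \<in> {1..n} \<Longrightarrow> regular_cond_law M (agent_info_limit M G S Y i) \<theta> (post_inf i)"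
  shows "(\<forall>i\<in>{1..n}. AE w in M. weakly_converges (\<lambda>t. post i t w) (post_inf i w)) \<and>
         (\<forall>i\<in>{1..n}. \<forall>j\<in>{1..n}. i \<rightarrow>\<^sup>*\<^bsub>G\<^esub> j \<longrightarrow> (AE w in M. post_inf i w = post_inf j w)) \<and>
         (Digraph_Component.connected G \<longrightarrow>
            (AE w in M. \<forall>i\<in>{1..n}. \<forall>j\<in>{1..n}. post_inf i w = post_inf j w))"
proof -
  interpret sampling_model M G n \<nu> P \<theta> S Y post by fact
  have "AE w in M. \<forall>i\<in>{1..n}. \<forall>j\<in>{1..n}. post_inf i w = post_inf j w"
    if "Digraph_Component.connected G"
    using reachable_agree[OF connected_reachable[OF that] assms(2)]
    by (intro AE_finite_allI) auto
  then show ?thesis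
    using posterior_converges_weakly assms(2) reachable_agree[OF _ assms(2)] by blast
qed

end
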